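(* For the crossed six-terminal tree $T_\times$, the covariance $Q_\star=GG^{*}$ and the functional $d\in\mathbb Q^9$ given in the context satisfy $$Q_\star\in\mathcal C_{\mathrm{reg}},\qquad d\cdot H_{T_\times}(Q_\star)<0,$$ whereas $$d\cdot H_{T_\times}(Q)>0\qquad\text{for every nonzero }Q\in\mathcal C_{\mathrm{parity}}.$$ Consequently $H_{T_\times}(Q_\star)\notin H_{T_\times}(\mathcal C_{\mathrm{parity}})$, so the inclusion $H_{T_\times}(\mathcal C_{\mathrm{parity}})\subsetneq H_{T_\times}(\mathcal C_{\mathrm{reg}})$ is strict.
   Context: Vectors in $\mathbb R^6$ are indexed by $0,\dots,5$, corresponding to the terminals $(1^-,1^+,2^-,2^+,0_1,0_2)$; $\mathbf 1$ is the all-ones vector; $Q$ ranges over real symmetric $6\times6$ matrices. $$\mathcal C_{\mathrm{reg}}=\{Q\succeq0:\ Q\mathbf 1=0,\ Q_{00}=Q_{11},\ Q_{22}=Q_{33}\}.$$ For $\varepsilon_1,\varepsilon_2\in\{\pm1\}$ put $\mathcal P_{\varepsilon_1,\varepsilon_2}=\{x\in\mathbb R^6:x_1=\varepsilon_1x_0,\ x_3=\varepsilon_2x_2\}$, and let $\mathcal C_{\mathrm{parity}}$ be the convex cone generated by $$\bigcup_{\varepsilon_1,\varepsilon_2\in\{\pm1\}}\{Q\succeq0:\ Q\mathbf 1=0,\ \operatorname{ran}Q\subseteq\mathcal P_{\varepsilon_1,\varepsilon_2}\}.$$ $T_\times$ is the caterpillar tree with leaf order $(2^+,1^-,0_1,2^-,1^+,0_2)$: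 two end cherries $\{2^+,1^-\}$ and $\{1^+,0_2\}$, with $0_1$ and then $2^-$ attached singly along the central chain. Choosing one side of the cut of each of its nine edges gives the subsets $S_1=\{2^+\}$, $S_2=\{1^-\}$, $S_3=\{0_1\}$, $S_4=\{2^-\}$, $S_5=\{1^+\}$, $S_6=\{0_2\}$, $S_7=\{2^+,1^-\}$, $S_8=\{2^+,1^-,0_1\}$, $S_9=\{1^+,0_2\}$, and $H_{T_\times}(Q)=(\mathbf 1_{S_j}^{*}Q\mathbf 1_{S_j})_{j=1}^9\in\mathbb R^9$. The matrix $G\in\mathbb Q^{6\times2}$ has rows (indices $0$ to $5$) $$\left(\tfrac{21}{116},-\tfrac5{29}\right),\ \left(0,\tfrac14\right),\ \left(0,\tfrac15\right),\ \left(-\tfrac3{17},-\tfrac8{85}\right),\ \left(0,-\tfrac7{10}\right),\ \left(-\tfrac9{1972},\tfrac{5093}{9860}\right),$$ and $$d=\left(\tfrac{49}{25},\tfrac{53}{20},\tfrac35,\tfrac{68}{25},\tfrac{159}{100},\tfrac{109}{50},\tfrac{33}{20},-\tfrac{149}{100},-\tfrac{13}{100}\right).$$ *)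

theory Defs
  imports "HOL-Analysis.Analysis"
begin

text \<open>Vectors in \<open>real ^ 6\<close> are indexed by \<open>0, \<dots>, 5\<close>; the following names record which terminal
  each index stands for. In the numeral type \<open>6\<close> one has \<open>6 = 0\<close>, so the library function
  \<open>vector\<close>, which numbers entries from \<open>1\<close>, is not used for this index type.\<close>

abbreviation t1m :: 6 where "t1m \<equiv> 0"  (* 1^- *)
abbreviation t1p :: 6 where "t1p \<equiv> 1"  (* 1^+ *)
abbreviation t2m :: 6 where "t2m \<equiv> 2"  (* 2^- *)
abbreviation t2p :: 6 where "t2p \<equiv> 3"  (* 2^+ *)
abbreviation t01 :: 6 where "t01 \<equiv> 4"  (* 0_1 *)
abbreviation t02 :: 6 where "t02 \<equiv> 5"  (* 0_2 *)

definition psd :: "real ^ 'n ^ 'n \<Rightarrow> bool" where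
  "psd Q \<longleftrightarrow> transpose Q = Q \<and> (\<forall>x. 0 \<le> x \<bullet> (Q *v x))"

text \<open>Here and below \<open>1 :: real ^ 6\<close> is the all-ones vector.\<close>

definition C_reg :: "(real ^ 6 ^ 6) set" where
  "C_reg = {Q. psd Q \<and> Q *v 1 = 0 \<and> Q $ 0 $ 0 = Q $ 1 $ 1 \<and> Q $ 2 $ 2 = Q $ 3 $ 3}"

definition parity_space :: "real \<Rightarrow> real \<Rightarrow> (real ^ 6) set" where
  "parity_space e1 e2 = {x. x $ 1 = e1 * x $ 0 \<and> x $ 3 = e2 * x $ 2}"

definition C_parity :: "(real ^ 6 ^ 6) set" where
  "C_parity = convex_cone hull
     (\<Union>e1\<in>{1, -1}. \<Union>e2\<in>{1, -1}.
        {Q. psd Q \<and> Q *v 1 = 0 \<and> range (\<lambda>x. Q *v x) \<subseteq> parity_space e1 e2})"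

text \<open>The crossed caterpillar tree, with inner vertices \<open>NA - NB - NC - ND\<close> along the central chain.
  Each edge is oriented so that its first endpoint lies on the chosen side of the cut.\<close>

datatype vertex = Leaf 6 | NA | NB | NC | ND

definition T_cross :: "(vertex \<times> vertex) list" where
  "T_cross =
     [(Leaf t2p, NA), (Leaf t1m, NA), (Leaf t01, NB), (Leaf t2m, NC), (Leaf t1p, ND), (Leaf t02, ND),
      (NA, NB), (NB, NC), (ND, NC)]"

text \<open>The leaves joined to \<open>v\<close> after deletion of the edge \<open>e\<close>.\<close>

definition cut_side :: "vertex \<times> vertex \<Rightarrow> vertex \<Rightarrow> 6 set" where
  "cut_side e v = {i. (v, Leaf i) \<in> ((set T_cross - {e}) \<union> (set T_cross - {e})\<inverse>)\<^sup>*}"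

definition cut_sets :: "6 set list" where
  "cut_sets = map (\<lambda>e. cut_side e (fst e)) T_cross"

definition indicator_vec :: "'n set \<Rightarrow> real ^ 'n" where
  "indicator_vec S = (\<chi> i. indicator S i)"

text \<open>Components of \<open>real ^ 9\<close> are numbered \<open>1, \<dots>, 9\<close> (with \<open>9 = 0\<close> as an index).\<close>

definition H_cross :: "real ^ 6 ^ 6 \<Rightarrow> real ^ 9" where
  "H_cross Q = vector (map (\<lambda>S. indicator_vec S \<bullet> (Q *v indicator_vec S)) cut_sets)"

lemma cut_sideI:
  assumes "\<forall>x\<in>I. \<forall>(a, b)\<in>set T_cross - {e}. (a = x \<longrightarrow> b \<in> I) \<and> (b = x \<longrightarrow> a \<in> I)"
    and "v \<in> I"
    and "\<forall>i. Leaf i \<in> I \<longleftrightarrow> i \<in> S"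
    and "\<forall>i\<in>S. (v, Leaf i) \<in> ((set T_cross - {e}) \<union> (set T_cross - {e})\<inverse>)\<^sup>*"
  shows "cut_side e v = S"
proof -
  have "w \<in> I" if "(v, w) \<in> ((set T_cross - {e}) \<union> (set T_cross - {e})\<inverse>)\<^sup>*" for w
    using that by (induction rule: rtrancl_induct) (use assms in fastforce)+
  then show ?thesis
    using assms(3,4) unfolding cut_side_def by blast
qed

lemma cut_sets_eq:
  "cut_sets = [{t2p}, {t1m}, {t01}, {t2m}, {t1p}, {t02}, {t2p, t1m}, {t2p, t1m, t01}, {t1p, t02}]"
proof -
  have "cut_side (Leaf i, v) (Leaf i) = {i}" if "(Leaf i, v) \<in> set T_cross" for i v
    by (rule cut_sideI[where I = "{Leaf i}"]) (use that in \<open>auto simp: T_cross_def\<close>)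
  moreover have "cut_side (NA, NB) NA = {t2p, t1m}"
  proof (rule cut_sideI[where I = "{NA, Leaf t2p, Leaf t1m}"])
    show "\<forall>i\<in>{t2p, t1m}. (NA, Leaf i) \<in> ((set T_cross - {(NA, NB)}) \<union> (set T_cross - {(NA, NB)})\<inverse>)\<^sup>*"
      by (auto simp: T_cross_def)
  qed (auto simp: T_cross_def)
  moreover have "cut_side (ND, NC) ND = {t1p, t02}"
  proof (rule cut_sideI[where I = "{ND, Leaf t1p, Leaf t02}"])
    show "\<forall>i\<in>{t1p, t02}. (ND, Leaf i) \<in> ((set T_cross - {(ND, NC)}) \<union> (set T_cross - {(ND, NC)})\<inverse>)\<^sup>*"
      by (auto simp: T_cross_def)
  qed (auto simp: T_cross_def)
  moreover have "cut_side (NB, NC) NB = {t2p, t1m, t01}"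
  proof (rule cut_sideI[where I = "{NA, NB, Leaf t2p, Leaf t1m, Leaf t01}"])
    let ?R = "(set T_cross - {(NB, NC)}) \<union> (set T_cross - {(NB, NC)})\<inverse>"
    have "(NB, NA) \<in> ?R" "(NA, Leaf t2p) \<in> ?R" "(NA, Leaf t1m) \<in> ?R" "(NB, Leaf t01) \<in> ?R"
      by (auto simp: T_cross_def)
    then show "\<forall>i\<in>{t2p, t1m, t01}. (NB, Leaf i) \<in> ?R\<^sup>*"
      by (auto simp del: Un_iff intro: rtrancl_trans)
  qed (auto simp: T_cross_def)
  ultimately show ?thesis
    by (simp add: cut_sets_def T_cross_def)
qed

lemma vector_9:
  fixes x1 x2 x3 x4 x5 x6 x7 x8 x9 :: "'a::zero"
  defines "v \<equiv> (vector [x1, x2, x3, x4, x5, x6, x7, x8, x9] :: 'a ^ 9)"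
  shows "v $ 1 = x1" "v $ 2 = x2" "v $ 3 = x3" "v $ 4 = x4" "v $ 5 = x5"
    "v $ 6 = x6" "v $ 7 = x7" "v $ 8 = x8" "v $ 9 = x9"
  unfolding v_def by (simp_all add: vector_def)

definition G_mat :: "real ^ 2 ^ 6" where
  "G_mat = (\<chi> i.
     if i = 0 then vector [21/116, - (5/29)]
     else if i = 1 then vector [0, 1/4]
     else if i = 2 then vector [0, 1/5]
     else if i = 3 then vector [- (3/17), - (8/85)]
     else if i = 4 then vector [0, - (7/10)]
     else vector [- (9/1972), 5093/9860])"

definition Q_star :: "real ^ 6 ^ 6" where
  "Q_star = G_mat ** transpose G_mat"

definition d_vec :: "real ^ 9" where
  "d_vec = vector
     [49/25, 53/20, 3/5, 68/25, 159/100, 109/50, 33/20, - (149/100), - (13/100)]"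

end

theory Submission
  imports Defs
begin

text \<open>
  The functional \<open>Q \<mapsto> d \<bullet> H(Q)\<close> is linear in \<open>Q\<close>: it is the trace pairing of \<open>Q\<close> with
  \<open>W = \<Sum>\<^sub>j d\<^sub>j 1\<^bsub>S\<^sub>j\<^esub> 1\<^bsub>S\<^sub>j\<^esub>\<^sup>*\<close>. Two coefficients of \<open>d\<close> are negative, and \<open>W\<close> is indefinite: the two
  columns of \<open>G\<close> make \<open>\<langle>W, G G\<^sup>*\<rangle>\<close> negative. But \<open>W\<close> is positive definite on each of the four
  three-dimensional spaces \<open>P\<^bsub>\<epsilon>1,\<epsilon>2\<^esub> \<inter> 1\<^sup>\<bottom>\<close>, and a generator of the parity cone has its range in one
  of them, so that its pairing with \<open>W\<close> is positive unless it is zero.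

  Positivity is carried by the bound \<open>trace Q \<le> 200 (d \<bullet> H(Q))\<close>. Being linear and non-strict, it holds
  on a convex cone, \<open>0\<close> included, and so passes from the generators (\<open>parity_margin\<close>) to the cone that
  they span (\<open>C_parity_bound\<close>) without any decomposition into nonzero generators. It yields strict
  positivity because the trace of a nonzero positive semidefinite matrix is positive
  (\<open>psd_trace_pos\<close>).

  The bound on generators is a finite computation. The parity relations and the vanishing
  row sums express all entries of \<open>Q\<close> through its principal block on the indices \<open>0, 2, 4\<close>. Then
  \<open>200 (d \<bullet> H(Q)) - trace Q\<close> is the pairing of that block with a positive definite \<open>3 \<times> 3\<close> matrix,
  and writing this matrix as a positive combination of three squares \<open>u u\<^sup>*\<close> displays the pairing
  as a positive combination of values \<open>u\<^sup>* Q u \<ge> 0\<close>.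
\<close>

section \<open>Coordinates\<close>

lemma exhaust_6: "x = 0 \<or> x = 1 \<or> x = 2 \<or> x = 3 \<or> x = 4 \<or> x = 5" for x :: 6
proof (induct x)
  case (of_int z)
  then have "0 \<le> z" and "z < 6" by simp_all
  then have "z = 0 \<or> z = 1 \<or> z = 2 \<or> z = 3 \<or> z = 4 \<or> z = 5" by arith
  then show ?case by auto
qed

lemma UNIV_6: "UNIV = {0, 1, 2, 3, 4, 5 :: 6}"
  using exhaust_6 by auto

lemma sum_6: "sum f (UNIV :: 6 set) = f 0 + f 1 + f 2 + f 3 + f 4 + f 5"
  unfolding UNIV_6 by (simp add: ac_simps)

lemma exhaust_9:
  "x = 1 \<or> x = 2 \<or> x = 3 \<or> x = 4 \<or> x = 5 \<or> x = 6 \<or> x = 7 \<or> x = 8 \<or> x = 9" for x :: 9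
proof (induct x)
  case (of_int z)
  then have "0 \<le> z" and "z < 9" by simp_all
  then have "z = 0 \<or> z = 1 \<or> z = 2 \<or> z = 3 \<or> z = 4 \<or> z = 5 \<or> z = 6 \<or> z = 7 \<or> z = 8"
    by arith
  then show ?case by auto
qed

lemma UNIV_9: "UNIV = {1, 2, 3, 4, 5, 6, 7, 8, 9 :: 9}"
  using exhaust_9 by auto

lemma sum_9: "sum f (UNIV :: 9 set) = f 1 + f 2 + f 3 + f 4 + f 5 + f 6 + f 7 + f 8 + f 9"
  unfolding UNIV_9 by (simp add: ac_simps)

lemma inner_9:
  "x \<bullet> y = x $ 1 * y $ 1 + x $ 2 * y $ 2 + x $ 3 * y $ 3 + x $ 4 * y $ 4 + x $ 5 * y $ 5
    + x $ 6 * y $ 6 + x $ 7 * y $ 7 + x $ 8 * y $ 8 + x $ 9 * y $ 9" for x y :: "real ^ 9"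
  by (simp only: inner_vec_def sum_9 inner_real_def)

lemma indicator_vec_form:
  fixes Q :: "real ^ 'n ^ 'n"
  shows "indicator_vec S \<bullet> (Q *v indicator_vec S) = (\<Sum>i\<in>S. \<Sum>j\<in>S. Q $ i $ j)"
  by (simp add: indicator_vec_def inner_vec_def matrix_vector_mult_def indicator_def
      if_distrib sum.If_cases cong: if_cong)

lemma d_H_cross_eq:
  "d_vec \<bullet> H_cross Q =
     49/25 * (\<Sum>i\<in>{3}. \<Sum>j\<in>{3}. Q $ i $ j) + 53/20 * (\<Sum>i\<in>{0}. \<Sum>j\<in>{0}. Q $ i $ j)
   + 3/5 * (\<Sum>i\<in>{4}. \<Sum>j\<in>{4}. Q $ i $ j) + 68/25 * (\<Sum>i\<in>{2}. \<Sum>j\<in>{2}. Q $ i $ j)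
   + 159/100 * (\<Sum>i\<in>{1}. \<Sum>j\<in>{1}. Q $ i $ j) + 109/50 * (\<Sum>i\<in>{5}. \<Sum>j\<in>{5}. Q $ i $ j)
   + 33/20 * (\<Sum>i\<in>{3, 0}. \<Sum>j\<in>{3, 0}. Q $ i $ j)
   - 149/100 * (\<Sum>i\<in>{3, 0, 4}. \<Sum>j\<in>{3, 0, 4}. Q $ i $ j)
   - 13/100 * (\<Sum>i\<in>{1, 5}. \<Sum>j\<in>{1, 5}. Q $ i $ j)"
  unfolding inner_9 d_vec_def H_cross_def cut_sets_eq indicator_vec_form list.map vector_9
  by simp

text \<open>Linearity is what lets an inequality checked on generators extend to the whole cone.\<close>

lemma linear_d_H_cross: "linear (\<lambda>Q. d_vec \<bullet> H_cross Q)"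
  by (rule linearI) (simp_all add: d_H_cross_eq field_simps)

section \<open>Positive semidefinite matrices\<close>

lemma psd_cone:
  fixes P Q :: "real ^ 'n ^ 'n"
  assumes "psd P" "psd Q"
  shows "psd (P + Q)" and "c \<ge> 0 \<Longrightarrow> psd (c *\<^sub>R P)"
  using assms
  by (auto simp: psd_def transpose_def vec_eq_iff matrix_vector_mult_add_rdistrib inner_right_distrib
      scaleR_matrix_vector_assoc[symmetric])

lemma psd_sym: "psd Q \<Longrightarrow> Q $ j $ i = Q $ i $ j"
  by (auto simp: psd_def transpose_def vec_eq_iff)

lemma axis_form: "axis i 1 \<bullet> (Q *v axis j 1) = Q $ i $ j" for Q :: "real ^ 'n ^ 'n"
  by (simp add: matrix_vector_mult_basis column_def inner_axis')

lemma psd_diag_nonneg: "psd Q \<Longrightarrow> 0 \<le> Q $ i $ i" for Q :: "real ^ 'n ^ 'n"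
  unfolding psd_def axis_form[symmetric] by blast

text \<open>Evaluate the form at \<open>e\<^sub>i + e\<^sub>j\<close> and at \<open>e\<^sub>i - e\<^sub>j\<close>.\<close>

lemma psd_offdiag_bound:
  fixes Q :: "real ^ 'n ^ 'n"
  assumes "psd Q"
  shows "2 * \<bar>Q $ i $ j\<bar> \<le> Q $ i $ i + Q $ j $ j"
proof -
  have "0 \<le> (axis i 1 + axis j 1) \<bullet> (Q *v (axis i 1 + axis j 1))"
       "0 \<le> (axis i 1 - axis j 1) \<bullet> (Q *v (axis i 1 - axis j 1))"
    using assms unfolding psd_def by blast+
  then have "0 \<le> Q $ i $ i + 2 * Q $ i $ j + Q $ j $ j" "0 \<le> Q $ i $ i - 2 * Q $ i $ j + Q $ j $ j"
    by (simp_all add: matrix_vector_right_distrib matrix_vector_mult_diff_distrib inner_simps axis_form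
        psd_sym[OF assms, of j i])
  then show ?thesis by linarith
qed

text \<open>If the trace vanished, so would every diagonal entry, and then every off-diagonal one.\<close>

lemma psd_trace_pos:
  fixes Q :: "real ^ 'n ^ 'n"
  assumes "psd Q" "Q \<noteq> 0"
  shows "0 < trace Q"
proof (rule ccontr)
  assume "\<not> 0 < trace Q"
  moreover have "0 \<le> trace Q"
    unfolding trace_def by (intro sum_nonneg psd_diag_nonneg assms(1))
  ultimately have "(\<Sum>i\<in>UNIV. Q $ i $ i) = 0"
    unfolding trace_def by simp
  then have "Q $ i $ i = 0" for i
    by (simp add: sum_nonneg_eq_0_iff psd_diag_nonneg[OF assms(1)])
  then have "Q $ i $ j = 0" for i j
    using psd_offdiag_bound[OF assms(1), of i j] by simp
  with assms(2) show False by (simp add: vec_eq_iff)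
qed

text \<open>The indices \<open>0, 2, 4\<close> are those whose block determines a parity generator. For well-chosen
  integers \<open>a, b, c\<close> these values of the form certify the bound on generators.\<close>

lemma psd_block_form_nonneg:
  fixes Q :: "real ^ 6 ^ 6"
  assumes "psd Q"
  shows "0 \<le> a\<^sup>2 * Q $ 0 $ 0 + b\<^sup>2 * Q $ 2 $ 2 + c\<^sup>2 * Q $ 4 $ 4
           + 2 * (a * b * Q $ 0 $ 2 + a * c * Q $ 0 $ 4 + b * c * Q $ 2 $ 4)"
proof -
  have sym: "Q $ j $ i = Q $ i $ j" for i j
    by (rule psd_sym[OF assms])
  let ?x = "(\<chi> i. if i = 0 then a else if i = 2 then b else if i = 4 then c else 0) :: real ^ 6"
  have "0 \<le> ?x \<bullet> (Q *v ?x)"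
    using assms unfolding psd_def by blast
  then show ?thesis
    by (simp add: inner_vec_def matrix_vector_mult_def sum_6 sym[of 2 0] sym[of 4 0] sym[of 4 2]
        algebra_simps power2_eq_square)
qed

section \<open>The parity cone\<close>

text \<open>Every column of \<open>Q\<close> lies in its range.\<close>

lemma parity_entries:
  fixes Q :: "real ^ 6 ^ 6"
  assumes "range (\<lambda>x. Q *v x) \<subseteq> parity_space e1 e2"
  shows "Q $ 1 $ j = e1 * Q $ 0 $ j" "Q $ 3 $ j = e2 * Q $ 2 $ j"
proof -
  have "Q *v axis j 1 \<in> parity_space e1 e2" using assms by blast
  then show "Q $ 1 $ j = e1 * Q $ 0 $ j" "Q $ 3 $ j = e2 * Q $ 2 $ j"
    by (auto simp: parity_space_def matrix_vector_mult_basis column_def)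
qed

text \<open>The form of \<open>W\<close> is positive definite on each space \<open>P\<^bsub>\<epsilon>1,\<epsilon>2\<^esub> \<inter> 1\<^sup>\<bottom>\<close>, with smallest eigenvalue
  above \<open>1/200\<close>. Any positive number below the four smallest eigenvalues would serve in place of
  \<open>1/200\<close>; this one keeps the integers in the certificates small. The two equalities of diagonal entries
  say that parity matrices are regular, since \<open>\<epsilon>\<^sub>1\<^sup>2 = \<epsilon>\<^sub>2\<^sup>2 = 1\<close>.\<close>

lemma parity_margin:
  fixes Q :: "real ^ 6 ^ 6"
  assumes "psd Q" and ones: "Q *v 1 = 0"
    and range: "range (\<lambda>x. Q *v x) \<subseteq> parity_space e1 e2"
    and e: "e1 \<in> {1, -1}" "e2 \<in> {1, -1}"
  shows "trace Q \<le> 200 * (d_vec \<bullet> H_cross Q)"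
    and "Q $ 0 $ 0 = Q $ 1 $ 1" "Q $ 2 $ 2 = Q $ 3 $ 3"
proof -
  have sym: "Q $ j $ i = Q $ i $ j" for i j
    by (rule psd_sym[OF assms(1)])
  have lower: "Q $ 1 $ 0 = Q $ 0 $ 1" "Q $ 2 $ 0 = Q $ 0 $ 2" "Q $ 3 $ 0 = Q $ 0 $ 3"
      "Q $ 4 $ 0 = Q $ 0 $ 4" "Q $ 5 $ 0 = Q $ 0 $ 5" "Q $ 2 $ 1 = Q $ 1 $ 2" "Q $ 3 $ 1 = Q $ 1 $ 3"
      "Q $ 4 $ 1 = Q $ 1 $ 4" "Q $ 5 $ 1 = Q $ 1 $ 5" "Q $ 3 $ 2 = Q $ 2 $ 3" "Q $ 4 $ 2 = Q $ 2 $ 4"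
      "Q $ 5 $ 2 = Q $ 2 $ 5" "Q $ 4 $ 3 = Q $ 3 $ 4" "Q $ 5 $ 3 = Q $ 3 $ 5" "Q $ 5 $ 4 = Q $ 4 $ 5"
    by (rule sym)+
  have row: "Q $ i $ 5 = - Q $ i $ 0 - Q $ i $ 1 - Q $ i $ 2 - Q $ i $ 3 - Q $ i $ 4" for i
    using arg_cong[OF ones, of "\<lambda>v. v $ i"] by (simp add: matrix_vector_mult_def sum_6)
  note par = parity_entries[OF range]
  have e_sq: "e1 * e1 = 1" "e2 * e2 = 1"
    using e by auto
  have par': "Q $ 0 $ 1 = e1 * Q $ 0 $ 0" "Q $ 1 $ 2 = e1 * Q $ 0 $ 2" "Q $ 1 $ 4 = e1 * Q $ 0 $ 4"
      "Q $ 0 $ 3 = e2 * Q $ 0 $ 2" "Q $ 2 $ 3 = e2 * Q $ 2 $ 2" "Q $ 3 $ 4 = e2 * Q $ 2 $ 4"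
      "Q $ 1 $ 3 = e1 * e2 * Q $ 0 $ 2"
    using par(1)[of 0] par(1)[of 2] par(1)[of 4] par(2)[of 0] par(2)[of 2] par(2)[of 4] par(1)[of 3]
    by (simp_all only: lower mult.assoc)
  show diag: "Q $ 0 $ 0 = Q $ 1 $ 1" "Q $ 2 $ 2 = Q $ 3 $ 3"
    using par(1)[of 1] par(2)[of 3] par'(1,5) e_sq by (simp_all flip: mult.assoc)
  \<comment> \<open>Rewriting with these facts leaves only the six entries of the block on \<open>0, 2, 4\<close>.\<close>
  note entries = d_H_cross_eq trace_def sum_6 lower row par' diag[symmetric]
  note form = psd_block_form_nonneg[OF assms(1)]
  consider "e1 = 1" "e2 = 1" | "e1 = 1" "e2 = -1" | "e1 = -1" "e2 = 1" | "e1 = -1" "e2 = -1"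
    using e by blast
  then show "trace Q \<le> 200 * (d_vec \<bullet> H_cross Q)"
  proof cases
    \<comment> \<open>In each case the three vectors come from completing the square in the \<open>3 \<times> 3\<close> form that
      represents \<open>200 (d \<bullet> H(Q)) - trace Q\<close>: they are the successive pivot rows, scaled to integers.
      The weights are positive multiples of the pivots, and linear arithmetic recovers them.
      The order of elimination varies with the case, to keep the integers small.\<close>
    case 1
    show ?thesis using form[of 273 260 115] form[of 16 47 0] form[of 1 0 0]
      by (simp add: entries 1 field_simps)
  next
    case 2
    show ?thesis using form[of 273 149 115] form[of 4383 "-2501" 0] form[of 0 1 0]
      by (simp add: entries 2 field_simps)
  next
    case 3
    show ?thesis using form[of 213 "-5" "-81"] form[of 0 1070 223] form[of 0 1 0]
      by (simp add: entries 3 field_simps)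
  next
    case 4
    show ?thesis using form[of 213 "-8" "-81"] form[of 0 10147 3791] form[of 0 1 0]
      by (simp add: entries 4 field_simps)
  qed
qed

lemma convex_cone_C_reg: "convex_cone C_reg"
  unfolding convex_cone_iff
  by (auto simp: C_reg_def psd_cone matrix_vector_mult_add_rdistrib
      scaleR_matrix_vector_assoc[symmetric]) (simp add: psd_def transpose_def vec_eq_iff)

text \<open>The regular matrices that satisfy the linear bound form a convex cone containing all the
  generators, hence containing \<open>C_parity\<close>.\<close>

lemma C_parity_bound: "Q \<in> C_reg \<and> trace Q \<le> 200 * (d_vec \<bullet> H_cross Q)" if "Q \<in> C_parity"
  using that unfolding C_parity_def
proof (rule hull_induct)
  fix P :: "real ^ 6 ^ 6"
  assume "P \<in> (\<Union>e1\<in>{1, -1}. \<Union>e2\<in>{1, -1}.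
    {Q. psd Q \<and> Q *v 1 = 0 \<and> range (\<lambda>x. Q *v x) \<subseteq> parity_space e1 e2})"
  then obtain e1 e2 where e: "e1 \<in> {1, -1}" "e2 \<in> {1, -1}"
    and P: "psd P" "P *v 1 = 0" "range (\<lambda>x. P *v x) \<subseteq> parity_space e1 e2"
    by (elim UN_E CollectE conjE)
  show "P \<in> C_reg \<and> trace P \<le> 200 * (d_vec \<bullet> H_cross P)"
    unfolding C_reg_def mem_Collect_eq by (intro conjI P(1,2) parity_margin[OF P e])
next
  note lin = linear_add[OF linear_d_H_cross] linear_cmul[OF linear_d_H_cross] linear_0[OF linear_d_H_cross]
  have trace_scaleR: "trace (c *\<^sub>R P) = c * trace P" for c and P :: "real ^ 6 ^ 6"
    by (simp add: trace_def sum_distrib_left)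
  show "convex_cone {Q. Q \<in> C_reg \<and> trace Q \<le> 200 * (d_vec \<bullet> H_cross Q)}"
    unfolding convex_cone_iff
  proof (intro conjI ballI allI impI; clarsimp)
    show "0 \<in> C_reg \<and> trace (0 :: real ^ 6 ^ 6) \<le> 200 * (d_vec \<bullet> H_cross 0)"
      using convex_cone_contains_0[OF convex_cone_C_reg] lin(3) by (simp add: trace_def)
  next
    fix P Q :: "real ^ 6 ^ 6"
    assume "P \<in> C_reg" "trace P \<le> 200 * (d_vec \<bullet> H_cross P)"
      "Q \<in> C_reg" "trace Q \<le> 200 * (d_vec \<bullet> H_cross Q)"
    then show "P + Q \<in> C_reg \<and> trace (P + Q) \<le> 200 * (d_vec \<bullet> H_cross (P + Q))"
      by (simp add: convex_cone_add[OF convex_cone_C_reg] lin(1) trace_add)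
  next
    fix P :: "real ^ 6 ^ 6" and c :: real
    assume "P \<in> C_reg" "trace P \<le> 200 * (d_vec \<bullet> H_cross P)" "0 \<le> c"
    moreover from this have "c * trace P \<le> c * (200 * (d_vec \<bullet> H_cross P))"
      by (intro mult_left_mono)
    ultimately show "c *\<^sub>R P \<in> C_reg \<and> trace (c *\<^sub>R P) \<le> 200 * (d_vec \<bullet> H_cross (c *\<^sub>R P))"
      by (simp add: convex_cone_scaleR[OF convex_cone_C_reg] lin(2) trace_scaleR)
  qed
qed

section \<open>The matrix outside the parity image\<close>

lemma psd_Gram: "psd (A ** transpose A)" for A :: "real ^ 'm ^ 'n"
proof -
  have "x \<bullet> ((A ** transpose A) *v x) = (transpose A *v x) \<bullet> (transpose A *v x)" for x
    by (simp flip: matrix_vector_mul_assoc dot_lmul_matrix)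
  then show ?thesis
    by (simp add: psd_def matrix_transpose_mul)
qed

lemma Q_star_entry: "Q_star $ i $ j = G_mat $ i $ 1 * G_mat $ j $ 1 + G_mat $ i $ 2 * G_mat $ j $ 2"
  by (simp add: Q_star_def matrix_matrix_mult_def transpose_def sum_2)

lemma G_mat_entries:
  "G_mat $ 0 = vector [21/116, - (5/29)]" "G_mat $ 1 = vector [0, 1/4]"
  "G_mat $ 2 = vector [0, 1/5]" "G_mat $ 3 = vector [- (3/17), - (8/85)]"
  "G_mat $ 4 = vector [0, - (7/10)]" "G_mat $ 5 = vector [- (9/1972), 5093/9860]"
  by (simp_all add: G_mat_def)

lemma Q_star_in_C_reg: "Q_star \<in> C_reg"
proof -
  have "psd Q_star"
    unfolding Q_star_def by (rule psd_Gram)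
  moreover have "Q_star *v 1 = 0"
    by (simp add: vec_eq_iff matrix_vector_mult_def sum_6 Q_star_entry G_mat_entries)
  ultimately show ?thesis
    by (simp add: C_reg_def Q_star_entry G_mat_entries)
qed

lemma d_H_cross_Q_star_neg: "d_vec \<bullet> H_cross Q_star < 0"
  by (simp add: d_H_cross_eq Q_star_entry G_mat_entries)

theorem theorem7p2:
  shows "Q_star \<in> C_reg
    \<and> d_vec \<bullet> H_cross Q_star < 0
    \<and> (\<forall>Q\<in>C_parity. Q \<noteq> 0 \<longrightarrow> d_vec \<bullet> H_cross Q > 0)
    \<and> H_cross Q_star \<notin> H_cross ` C_parity
    \<and> H_cross ` C_parity \<subset> H_cross ` C_reg"
proof -
  have pos: "d_vec \<bullet> H_cross Q > 0" if "Q \<in> C_parity" "Q \<noteq> 0" for Q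
    using C_parity_bound[OF that(1)] psd_trace_pos[of Q] that(2) by (auto simp: C_reg_def)
  \<comment> \<open>The separation has to cover the zero matrix as well, since it belongs to \<open>C_parity\<close>.\<close>
  have "d_vec \<bullet> H_cross Q \<ge> 0" if "Q \<in> C_parity" for Q
    using pos[OF that] linear_0[OF linear_d_H_cross] by (cases "Q = 0") auto
  then have notin: "H_cross Q_star \<notin> H_cross ` C_parity"
    using d_H_cross_Q_star_neg by fastforce
  have "C_parity \<subseteq> C_reg"
    using C_parity_bound by blast
  then have "H_cross ` C_parity \<subset> H_cross ` C_reg"
    using notin Q_star_in_C_reg by blast
  then show ?thesis
    using Q_star_in_C_reg d_H_cross_Q_star_neg pos notin by blast
qed

end
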